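(* Let $X$ be a strong $R$-space and $U$ a nonempty saturated subset of $X$. Then $U$, with the subspace topology, is a strong $R$-space.
   Context: For a $T_0$-space $X$: a subset is saturated if it equals the intersection of all open sets containing it (equivalently, it is an upper set in the specialization order $x\le_X y\iff x\in\overline{\{y\}}$); $Q(X)$ is the set of all nonempty compact saturated subsets of $X$ (compactness is the open-cover property). A $T_0$-space $X$ is a strong $R$-space if for every nonempty family $\{K_i: i\in I\}\subseteq Q(X)$ and every open $V\subseteq X$, $\bigcap_{i\in I}K_i\subseteq V$ implies $\bigcap_{i\in J}K_i\subseteq V$ for some nonempty finite $J\subseteq I$. *)

theory Defs
  imports "HOL-Analysis.Abstract_Topological_Spaces"
begin

text \<open>The explicit inclusion in the carrier is not redundant: for a set that is not contained
  in the carrier there is no open superset, and the empty intersection is \<^term>\<open>UNIV\<close>.\<close>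

definition saturated_in :: "'a topology \<Rightarrow> 'a set \<Rightarrow> bool" where
  "saturated_in X A \<longleftrightarrow> A \<subseteq> topspace X \<and> A = \<Inter>{U. openin X U \<and> A \<subseteq> U}"

definition Q_sets :: "'a topology \<Rightarrow> 'a set set" where
  "Q_sets X = {K. K \<noteq> {} \<and> compactin X K \<and> saturated_in X K}"

text \<open>A definition cannot quantify over all index types, so families are given as sets of sets;
  the lemma below recovers the formulation with indexed families over any index type.\<close>

definition strong_R_space :: "'a topology \<Rightarrow> bool" where
  "strong_R_space X \<longleftrightarrow>
     t0_space X \<and>
     (\<forall>\<K> V. \<K> \<noteq> {} \<and> \<K> \<subseteq> Q_sets X \<and> openin X V \<and> \<Inter>\<K> \<subseteq> V \<longrightarrow>
        (\<exists>\<F>. finite \<F> \<and> \<F> \<noteq> {} \<and> \<F> \<subseteq> \<K> \<and> \<Inter>\<F> \<subseteq> V))"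

lemma strong_R_space_indexed:
  fixes K :: "'i \<Rightarrow> 'a set"
  assumes "strong_R_space X" "I \<noteq> {}" "\<And>i. i \<in> I \<Longrightarrow> K i \<in> Q_sets X"
    and "openin X V" "(\<Inter>i\<in>I. K i) \<subseteq> V"
  shows "\<exists>J. finite J \<and> J \<noteq> {} \<and> J \<subseteq> I \<and> (\<Inter>i\<in>J. K i) \<subseteq> V"
proof -
  have "K ` I \<noteq> {}" "K ` I \<subseteq> Q_sets X"
    using assms by auto
  then obtain \<F> where F: "finite \<F>" "\<F> \<noteq> {}" "\<F> \<subseteq> K ` I" "\<Inter>\<F> \<subseteq> V"
    using assms(1,4,5) unfolding strong_R_space_def by meson
  then obtain J where "J \<subseteq> I" "finite J" "\<F> = K ` J"
    by (meson finite_subset_image)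
  with F show ?thesis
    by auto
qed

end

theory Submission
  imports Defs
begin

text \<open>Since \<open>U\<close> is saturated, the compact saturated subsets of the subspace
  \<open>U\<close> are also compact saturated in \<open>X\<close>
  (\<open>Q_sets_subtopology_subset\<close>). An open set of \<open>U\<close> is a trace
  \<open>W \<inter> U\<close> with \<open>W\<close> open in \<open>X\<close>, so the property of
  \<open>X\<close>, applied to the same family and \<open>W\<close>, yields a finite subfamily with
  intersection inside \<open>W\<close>. Its members lie in \<open>U\<close>, so the intersection
  lies in \<open>W \<inter> U\<close>.\<close>

lemma saturated_in_subtopology_imp:
  assumes "saturated_in X U" "saturated_in (subtopology X U) K"
  shows "saturated_in X K"
proof -
  have KU: "K \<subseteq> U" and KX: "K \<subseteq> topspace X"
    and K: "K = \<Inter>{W. openin (subtopology X U) W \<and> K \<subseteq> W}"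
    using assms(2) unfolding saturated_in_def by auto
  have U: "U = \<Inter>{W. openin X W \<and> U \<subseteq> W}"
    using assms(1) unfolding saturated_in_def by blast
  have "x \<in> K" if x: "x \<in> \<Inter>{W. openin X W \<and> K \<subseteq> W}" for x
  proof -
    have "x \<in> U"
      \<comment> \<open>Every open superset of \<open>U\<close> contains \<open>K\<close>, hence
        contains \<open>x\<close>.\<close>
      using x KU by (subst U) blast
    \<comment> \<open>\<open>W\<close> is the trace on \<open>U\<close> of an open set of
      \<open>X\<close> that contains \<open>K\<close>, and that set contains
      \<open>x\<close>.\<close>
    then have "x \<in> W" if "openin (subtopology X U) W" "K \<subseteq> W" for W
      using x that unfolding openin_subtopology by auto
    then show "x \<in> K"
      by (subst K) blast
  qed
  then show ?thesis
    using KX unfolding saturated_in_def by blast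
qed

text \<open>Compactness of a subset of \<open>U\<close> is the same in \<open>U\<close> and in
  \<open>X\<close>, so only saturation has to be transferred.\<close>

lemma Q_sets_subtopology_subset:
  assumes "saturated_in X U"
  shows "Q_sets (subtopology X U) \<subseteq> Q_sets X"
  using saturated_in_subtopology_imp[OF assms]
  by (auto simp: Q_sets_def compactin_subtopology)

theorem proposition5p2:
  fixes X :: "'a topology" and U :: "'a set"
  assumes "strong_R_space X"
    and "U \<noteq> {}"
    and "saturated_in X U"
  shows "strong_R_space (subtopology X U)"
  unfolding strong_R_space_def
proof (intro conjI allI impI)
  show "t0_space (subtopology X U)"
    using assms(1) by (simp add: strong_R_space_def t0_space_subtopology)
next
  fix \<K> V
  assume "\<K> \<noteq> {} \<and> \<K> \<subseteq> Q_sets (subtopology X U) \<and> openin (subtopology X U) V \<and> \<Inter>\<K> \<subseteq> V"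
  then have K: "\<K> \<noteq> {}" "\<K> \<subseteq> Q_sets (subtopology X U)" "\<Inter>\<K> \<subseteq> V"
    and "openin (subtopology X U) V"
    by auto
  then obtain W where W: "openin X W" "V = W \<inter> U"
    unfolding openin_subtopology by auto
  have "\<K> \<subseteq> Q_sets X" "\<Inter>\<K> \<subseteq> W"
    using K W Q_sets_subtopology_subset[OF assms(3)] by auto
  with assms(1) K(1) W(1) obtain \<F> where F: "finite \<F>" "\<F> \<noteq> {}" "\<F> \<subseteq> \<K>" "\<Inter>\<F> \<subseteq> W"
    unfolding strong_R_space_def by meson
  have "A \<subseteq> U" if "A \<in> \<F>" for A
    using that F(3) K(2) by (auto simp: Q_sets_def compactin_subtopology)
  \<comment> \<open>Here \<open>\<F>\<close> must be nonempty, because \<open>\<Inter>{}\<close> is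
    \<open>UNIV\<close>.\<close>
  with F(2) have "\<Inter>\<F> \<subseteq> U"
    by blast
  with F W(2) show "\<exists>\<F>. finite \<F> \<and> \<F> \<noteq> {} \<and> \<F> \<subseteq> \<K> \<and> \<Inter>\<F> \<subseteq> V"
    by blast
qed

end
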